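(* Let $(A,B,C,D)\in\mathcal{M}_k^j(\rho)$. Then $C_p,D_p\neq 0$ for all $p=1,2$. In particular, $$\left\{\Omega_j\omega_r\::\:r=\tfrac{j}{2},j,k-\tfrac{j}{2}-1,k-1\right\}\subset\mathrm{Eval}(G),$$ with $C_1\in\mathrm{Evec}(G,\Omega_j\omega_{\frac{j}{2}})$, $C_2\in\mathrm{Evec}(G,\Omega_j\omega_j)$, $D_1\in\mathrm{Ecovec}(G,\Omega_j\omega_{k-\frac{j}{2}-1})$, $D_2\in\mathrm{Ecovec}(G,\Omega_j\omega_{k-1})$.
   Context: Non-singular monad matrices are $(A,B,C,D)$ with $A\in GL(k,\mathbb{C})$, $B\in Mat_{k\times k}(\mathbb{C})$, $C\in Mat_{k\times 2}(\mathbb{C})$, $D\in Mat_{2\times k}(\mathbb{C})$, satisfying $[A,B]+CD=0$ and the full-rank conditions, considered up to $(A,B,C,D)\sim(hAh^{-1},hBh^{-1},hC,Dh^{-1})$; $C_p$ is the $p$-th column of $C$ and $D_p$ the $p$-th row of $D$. Fix $j\in\mathbb{Z}_{2k}$ even and $\omega\in(-\pi,\pi)$. $\mathcal{M}_k^j(\rho)$ is the set of such matrices for which there is $g\in GL(k,\mathbb{C})$ with $e^{\imath\frac{j\pi}{k}}A=gAg^{-1}$, $e^{\imath\frac{\pi}{k}}B=g(B-C_1D_1A^{-1})g^{-1}$, $e^{\imath\frac{\pi}{2k}}e^{\imath\frac{j\pi}{4k}}C_1=e^{\imath\omega}gC_2$, $e^{\imath\frac{\pi}{2k}}e^{\imath\frac{3j\pi}{4k}}C_2=e^{-\imath\omega}gAC_1$,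 $e^{\imath\frac{\pi}{2k}}e^{\imath\frac{3j\pi}{4k}}D_1=e^{-\imath\omega}D_2g^{-1}$, $e^{\imath\frac{\pi}{2k}}e^{\imath\frac{j\pi}{4k}}D_2=e^{\imath\omega}D_1A^{-1}g^{-1}$ (invariance under $\rho(C_{2k}^{j,\omega})$). Then with $G=e^{-\imath\frac{j\pi}{2k}}g^2A$ one has $e^{\imath\frac{2j\pi}{k}}A=GAG^{-1}$, $e^{\imath\frac{2\pi}{k}}B=GBG^{-1}$, $e^{\imath\frac{\pi}{k}}C=GC\,\mathrm{adj}(\sigma_{2j\pi/k})$, $e^{\imath\frac{\pi}{k}}D=\sigma_{2j\pi/k}DG^{-1}$, where $\sigma_\varphi=\mathrm{diag}(e^{-\imath\frac{3\varphi}{4}},e^{-\imath\frac{\varphi}{4}})$, $\mathrm{adj}(\sigma)=\det(\sigma)\sigma^{-1}$. Notation: $\Omega_j=e^{\imath\frac{(2-j)\pi}{2k}}$, $\omega_r=e^{\imath\frac{2\pi r}{k}}$ (indices mod $k$); $\mathrm{Evec}(G,\lambda)$ is the $\lambda$-eigenspace of $G$ and $\mathrm{Ecovec}(G,\lambda)$ the space of row vectors $v$ with $vG=\lambda v$. *)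

theory Defs
  imports "HOL-Analysis.Analysis"
begin

(* Matrices are k x k complex matrices indexed by a finite type 'k, k = CARD('k).
   C in Mat_{k x 2} is given by its two columns c1 c2 (C_1, C_2);
   D in Mat_{2 x k} is given by its two rows d1 d2 (D_1, D_2). *)

definition outer :: "complex^'k \<Rightarrow> complex^'k \<Rightarrow> complex^'k^'k" where
  "outer u v = (\<chi> i l. u$i * v$l)"

(* the matrix C D = C_1 D_1 + C_2 D_2 *)
definition CD_mat :: "complex^'k \<Rightarrow> complex^'k \<Rightarrow> complex^'k \<Rightarrow> complex^'k \<Rightarrow> complex^'k^'k" where
  "CD_mat c1 c2 d1 d2 = outer c1 d1 + outer c2 d2"

(* row vector applied to column vector *)
definition rowapp :: "complex^'k \<Rightarrow> complex^'k \<Rightarrow> complex" where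
  "rowapp d v = (\<Sum>i\<in>UNIV. d$i * v$i)"

(* Non-singular monad matrices: A invertible, [A,B] + CD = 0, and the full rank conditions:
   for all (x,y), the (2k+2) x k matrix (A - x; B - y; D) is injective and the
   k x (2k+2) matrix (-(B - y), A - x, C) is surjective. *)
definition monad_nonsingular ::
  "complex^'k^'k \<Rightarrow> complex^'k^'k \<Rightarrow> complex^'k \<Rightarrow> complex^'k \<Rightarrow> complex^'k \<Rightarrow> complex^'k \<Rightarrow> bool" where
  "monad_nonsingular A B c1 c2 d1 d2 \<longleftrightarrow>
     invertible A \<and>
     (A ** B - B ** A) + CD_mat c1 c2 d1 d2 = 0 \<and>
     (\<forall>x y :: complex.
        (\<forall>v. (A - mat x) *v v = 0 \<and> (B - mat y) *v v = 0 \<and> rowapp d1 v = 0 \<and> rowapp d2 v = 0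
              \<longrightarrow> v = 0) \<and>
        (\<forall>w. \<exists>u1 u2 a b. w = - ((B - mat y) *v u1) + (A - mat x) *v u2 + a *s c1 + b *s c2))"

(* invariance under rho(C_{2k}^{j,omega}) witnessed by g *)
definition rho_invariant_by ::
  "nat \<Rightarrow> real \<Rightarrow> complex^'k^'k \<Rightarrow> complex^'k^'k \<Rightarrow> complex^'k \<Rightarrow> complex^'k \<Rightarrow> complex^'k \<Rightarrow> complex^'k
   \<Rightarrow> complex^'k^'k \<Rightarrow> bool" where
  "rho_invariant_by j \<omega> A B c1 c2 d1 d2 g \<longleftrightarrow>
     (let k = real CARD('k) in
     invertible g \<and>
     mat (cis (real j * pi / k)) ** A = g ** A ** matrix_inv g \<and>
     mat (cis (pi / k)) ** B = g ** (B - outer c1 d1 ** matrix_inv A) ** matrix_inv g \<and>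
     (cis (pi / (2 * k)) * cis (real j * pi / (4 * k))) *s c1 = cis \<omega> *s (g *v c2) \<and>
     (cis (pi / (2 * k)) * cis (3 * real j * pi / (4 * k))) *s c2 = cis (- \<omega>) *s (g *v (A *v c1)) \<and>
     (cis (pi / (2 * k)) * cis (3 * real j * pi / (4 * k))) *s d1 = cis (- \<omega>) *s (d2 v* matrix_inv g) \<and>
     (cis (pi / (2 * k)) * cis (real j * pi / (4 * k))) *s d2 = cis \<omega> *s (d1 v* (matrix_inv A ** matrix_inv g)))"

(* the set M_k^j(rho) *)
definition M_rho ::
  "nat \<Rightarrow> real \<Rightarrow> ((complex^'k^'k) \<times> (complex^'k^'k) \<times> (complex^'k) \<times> (complex^'k) \<times> (complex^'k) \<times> (complex^'k)) set" where
  "M_rho j \<omega> = {(A, B, c1, c2, d1, d2). monad_nonsingular A B c1 c2 d1 d2 \<and>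
                   (\<exists>g. rho_invariant_by j \<omega> A B c1 c2 d1 d2 g)}"

definition Evec :: "complex^'k^'k \<Rightarrow> complex \<Rightarrow> (complex^'k) set" where
  "Evec G lam = {v. G *v v = lam *s v}"

definition Ecovec :: "complex^'k^'k \<Rightarrow> complex \<Rightarrow> (complex^'k) set" where
  "Ecovec G lam = {v. v v* G = lam *s v}"

definition Eval :: "complex^'k^'k \<Rightarrow> complex set" where
  "Eval G = {lam. \<exists>v. v \<noteq> 0 \<and> G *v v = lam *s v}"

(* Omega_j = e^{i (2-j) pi / (2k)},  omega_r = e^{i 2 pi r / k} *)
definition Omega_j :: "nat \<Rightarrow> nat \<Rightarrow> complex" where
  "Omega_j k j = cis ((2 - real j) * pi / (2 * real k))"

definition omega_r :: "nat \<Rightarrow> int \<Rightarrow> complex" where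
  "omega_r k r = cis (2 * pi * real_of_int r / real k)"

end

theory Submission
  imports Defs "HOL-Computational_Algebra.Fundamental_Theorem_Algebra"
begin

(* Invariance under rho makes g permute the columns C_1, C_2 and the rows D_1, D_2 cyclically up to
   phases, while conjugating A into a scalar multiple of A.  Hence G = e^(-ij pi/2k) g^2 A acts on
   each C_p and D_p by an explicit scalar.  The same cycle gives C_1 = 0 <-> C_2 = 0 and
   D_1 = 0 <-> D_2 = 0; and C = 0 (or D = 0) is impossible for a non-singular monad, since then
   [A,B] = 0, so A and B share a (left) eigenvector, contradicting the full-rank conditions. *)

definition poly_matrix_apply :: "complex poly \<Rightarrow> complex^'n^'n \<Rightarrow> complex^'n \<Rightarrow> complex^'n" where
  "poly_matrix_apply p M v = (\<Sum>i\<le>degree p. coeff p i *s ((*v) M ^^ i) v)"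

lemma poly_matrix_apply_eq_sum:
  assumes "degree p \<le> n"
  shows "poly_matrix_apply p M v = (\<Sum>i\<le>n. coeff p i *s ((*v) M ^^ i) v)"
  unfolding poly_matrix_apply_def
  by (rule sum.mono_neutral_left) (use assms in \<open>auto simp: coeff_eq_0\<close>)

lemma poly_matrix_apply_add:
  "poly_matrix_apply (p + q) M v = poly_matrix_apply p M v + poly_matrix_apply q M v"
proof -
  let ?n = "max (degree p) (degree q)"
  have "degree (p + q) \<le> ?n" by (simp add: degree_add_le)
  then show ?thesis
    by (simp add: poly_matrix_apply_eq_sum[of _ ?n] vector_sadd_rdistrib sum.distrib)
qed

lemma poly_matrix_apply_smult: "poly_matrix_apply (smult c p) M v = c *s poly_matrix_apply p M v"
  by (simp add: poly_matrix_apply_eq_sum[of "smult c p" "degree p"] poly_matrix_apply_def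
      vec.scale_sum_right vector_smult_assoc)

lemma poly_matrix_apply_const: "poly_matrix_apply [:c:] M v = c *s v"
  by (simp add: poly_matrix_apply_def)

lemma poly_matrix_apply_monom: "poly_matrix_apply (monom c n) M v = c *s ((*v) M ^^ n) v"
  by (simp add: poly_matrix_apply_eq_sum[of _ n] degree_monom_le if_distrib[of "\<lambda>c. c *s _"]
      cong: if_cong)

lemma poly_matrix_apply_0 [simp]: "poly_matrix_apply 0 M v = 0"
  by (simp add: poly_matrix_apply_def)

lemma poly_matrix_apply_sum:
  "poly_matrix_apply (\<Sum>x\<in>A. f x) M v = (\<Sum>x\<in>A. poly_matrix_apply (f x) M v)"
  by (induct A rule: infinite_finite_induct) (simp_all add: poly_matrix_apply_add)

lemma poly_matrix_apply_pCons_0: "poly_matrix_apply (pCons 0 q) M v = M *v poly_matrix_apply q M v"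
proof -
  have "poly_matrix_apply (pCons 0 q) M v
      = (\<Sum>i\<le>Suc (degree q). coeff (pCons 0 q) i *s ((*v) M ^^ i) v)"
    by (rule poly_matrix_apply_eq_sum) (simp add: degree_pCons_le)
  also have "\<dots> = (\<Sum>i\<le>degree q. coeff q i *s ((*v) M ^^ Suc i) v)"
    by (subst sum.atMost_Suc_shift) simp
  also have "\<dots> = M *v poly_matrix_apply q M v"
    by (simp add: poly_matrix_apply_def vec.sum vector_scalar_commute)
  finally show ?thesis .
qed

lemma poly_matrix_apply_linear_factor:
  "poly_matrix_apply ([:-z, 1:] * q) M v = M *v poly_matrix_apply q M v - z *s poly_matrix_apply q M v"
proof -
  have "[:-z, 1:] * q = smult (-z) q + pCons 0 q" by simp
  then show ?thesis
    by (simp only: poly_matrix_apply_add poly_matrix_apply_smult poly_matrix_apply_pCons_0)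
      (simp add: vector_smult_lneg)
qed

lemma poly_matrix_apply_in_subspace:
  assumes "vec.subspace S" "\<And>x. x \<in> S \<Longrightarrow> M *v x \<in> S" "v \<in> S"
  shows "poly_matrix_apply p M v \<in> S"
proof -
  have "((*v) M ^^ i) v \<in> S" for i
    by (induct i) (simp_all add: assms)
  then show ?thesis
    unfolding poly_matrix_apply_def by (intro vec.subspace_sum vec.subspace_scale assms(1))
qed

lemma eigenvector_of_annihilated:
  assumes S: "vec.subspace S" "\<And>x. x \<in> S \<Longrightarrow> M *v x \<in> S"
    and v: "v \<in> S" "v \<noteq> 0"
  shows "p \<noteq> 0 \<Longrightarrow> poly_matrix_apply p M v = 0 \<Longrightarrow> \<exists>w\<in>S. w \<noteq> 0 \<and> (\<exists>l. M *v w = l *s w)"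
proof (induction "degree p" arbitrary: p rule: less_induct)
  case less
  show ?case
  proof (cases "degree p = 0")
    case True
    then obtain c where "p = [:c:]" by (metis degree_eq_zeroE)
    with less.prems v show ?thesis by (simp add: poly_matrix_apply_const)
  next
    case False
    then obtain z where "poly p z = 0"
      using fundamental_theorem_of_algebra[of p] by (auto simp: constant_degree)
    then obtain q where pq: "p = [:-z, 1:] * q"
      by (auto simp: poly_eq_0_iff_dvd elim: dvdE)
    with less.prems have "q \<noteq> 0" by auto
    then have "degree q < degree p"
      unfolding pq by (subst degree_mult_eq) auto
    show ?thesis
    proof (cases "poly_matrix_apply q M v = 0")
      case True
      with less.hyps \<open>degree q < degree p\<close> \<open>q \<noteq> 0\<close> show ?thesis by blast
    next
      case False
      have "M *v poly_matrix_apply q M v = z *s poly_matrix_apply q M v"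
        using less.prems(2) unfolding pq poly_matrix_apply_linear_factor by simp
      with False poly_matrix_apply_in_subspace[OF S v(1)] show ?thesis by blast
    qed
  qed
qed

lemma poly_matrix_annihilator_exists:
  fixes M :: "complex^'n^'n"
  shows "\<exists>p. p \<noteq> 0 \<and> poly_matrix_apply p M v = 0"
proof -
  define f where "f i = ((*v) M ^^ i) v" for i
  let ?N = "CARD('n)"
  show ?thesis
  proof (cases "inj_on f {..?N}")
    case False
    then obtain i i' where ii': "i \<noteq> i'" "f i = f i'" unfolding inj_on_def by blast
    let ?p = "monom 1 i + smult (-1) (monom (1::complex) i')"
    have "coeff ?p i = 1" using ii' by simp
    then have "?p \<noteq> 0" by (metis coeff_0 zero_neq_one)
    moreover have "poly_matrix_apply ?p M v = 0"
      using ii' unfolding f_def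
      by (simp only: poly_matrix_apply_add poly_matrix_apply_smult poly_matrix_apply_monom)
        (simp add: vector_smult_lneg)
    ultimately show ?thesis by blast
  next
    case True
    then have "card (f ` {..?N}) > vec.dim (f ` {..?N})"
      using dim_subset_UNIV_cart_gen[of "f ` {..?N}"] by (simp add: card_image)
    then have "vec.dependent (f ` {..?N})"
      by (intro vec.dependent_biggerset_general) simp
    then obtain T u where T: "finite T" "T \<subseteq> f ` {..?N}" "(\<Sum>w\<in>T. u w *s w) = 0"
      and "\<exists>w\<in>T. u w \<noteq> 0"
      unfolding vec.dependent_explicit by blast
    then obtain I where I: "I \<subseteq> {..?N}" "T = f ` I" by (auto simp: subset_image_iff)
    with \<open>\<exists>w\<in>T. u w \<noteq> 0\<close> obtain i0 where i0: "i0 \<in> I" "u (f i0) \<noteq> 0" by blast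
    have inj: "inj_on f I" using True I(1) by (rule inj_on_subset)
    have "finite I" using I(1) finite_subset by blast
    let ?p = "\<Sum>i\<in>I. monom (u (f i)) i"
    have "coeff ?p i0 = u (f i0)"
      using \<open>finite I\<close> i0(1) by (simp add: coeff_sum)
    then have "?p \<noteq> 0" using i0(2) by (metis coeff_0)
    moreover have "poly_matrix_apply ?p M v = (\<Sum>w\<in>T. u w *s w)"
      unfolding I(2) sum.reindex[OF inj] poly_matrix_apply_sum poly_matrix_apply_monom f_def
      by simp
    ultimately show ?thesis using T(3) by auto
  qed
qed

lemma invariant_subspace_eigenvector:
  fixes M :: "complex^'n^'n"
  assumes "vec.subspace S" "\<And>x. x \<in> S \<Longrightarrow> M *v x \<in> S" "v \<in> S" "v \<noteq> 0"
  shows "\<exists>w\<in>S. w \<noteq> 0 \<and> (\<exists>l. M *v w = l *s w)"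
  using poly_matrix_annihilator_exists eigenvector_of_annihilated[OF assms] by blast

lemma commuting_matrices_common_eigenvector:
  fixes A B :: "complex^'n^'n"
  assumes AB: "A ** B = B ** A"
  shows "\<exists>v x y. v \<noteq> 0 \<and> A *v v = x *s v \<and> B *v v = y *s v"
proof -
  have "(1::complex^'n) \<noteq> 0" by (simp add: vec_eq_iff)
  then obtain w x where w: "w \<noteq> 0" "A *v w = x *s w"
    using invariant_subspace_eigenvector[OF vec.subspace_UNIV] by blast
  let ?E = "{u. A *v u = x *s u}"
  have "vec.subspace ?E"
    by (auto simp: vec.subspace_def matrix_vector_right_distrib vector_add_ldistrib
        vector_scalar_commute)
  moreover have "B *v u \<in> ?E" if "A *v u = x *s u" for u
  proof -
    have "A *v (B *v u) = B *v (A *v u)" by (simp add: matrix_vector_mul_assoc AB)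
    then show ?thesis using that by (simp add: vector_scalar_commute)
  qed
  ultimately obtain v y where "v \<in> ?E" "v \<noteq> 0" "B *v v = y *s v"
    using invariant_subspace_eigenvector[of ?E B w] w by auto
  then show ?thesis by blast
qed

lemma commuting_matrices_common_left_eigenvector:
  fixes A B :: "complex^'n^'n"
  assumes "A ** B = B ** A"
  shows "\<exists>v x y. v \<noteq> 0 \<and> v v* A = x *s v \<and> v v* B = y *s v"
  using commuting_matrices_common_eigenvector[of "transpose A" "transpose B"] assms
  by (simp flip: matrix_transpose_mul)

lemma matrix_vector_mult_mat: "mat s *v (u::'a::comm_ring_1^'n) = s *s u"
  unfolding matrix_vector_mult_def mat_def vec_eq_iff
  by (simp add: if_distrib[of "\<lambda>t. t * _"] cong: if_cong)

lemma vector_matrix_mult_mat: "(u::'a::comm_ring_1^'n) v* mat s = s *s u"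
  unfolding vector_matrix_mult_def mat_def vec_eq_iff
  by (simp add: if_distrib[of "\<lambda>t. _ * t"] mult.commute cong: if_cong)

lemma vector_matrix_mult_diff: "(u::'a::comm_ring_1^'n) v* (X - Y) = u v* X - u v* Y"
  unfolding vector_matrix_mult_def vec_eq_iff
  by (simp add: right_diff_distrib sum_subtractf)

lemma invertible_matrix_inv:
  assumes "invertible (g::'a::semiring_1^'n^'n)"
  shows "g ** matrix_inv g = mat 1" "matrix_inv g ** g = mat 1"
proof -
  from assms obtain g' where "g ** g' = mat 1 \<and> g' ** g = mat 1" unfolding invertible_def by blast
  then have "g ** matrix_inv g = mat 1 \<and> matrix_inv g ** g = mat 1"
    unfolding matrix_inv_def by (rule someI)
  then show "g ** matrix_inv g = mat 1" "matrix_inv g ** g = mat 1" by auto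
qed

lemma left_eigenvalue_in_Eval:
  fixes G :: "complex^'n^'n"
  assumes "d \<noteq> 0" "d v* G = l *s d"
  shows "l \<in> Eval G"
proof (rule ccontr)
  assume "l \<notin> Eval G"
  then have "\<forall>v. (G - mat l) *v v = 0 \<longrightarrow> v = 0"
    unfolding Eval_def by (auto simp: matrix_vector_mult_diff_rdistrib matrix_vector_mult_mat)
  then obtain H where "(G - mat l) ** H = mat 1"
    using matrix_left_invertible_ker matrix_left_right_inverse by blast
  then obtain H' where "H' ** transpose (G - mat l) = mat 1"
    using left_invertible_transpose by blast
  then have "\<forall>v. transpose (G - mat l) *v v = 0 \<longrightarrow> v = 0"
    using matrix_left_invertible_ker by blast
  moreover have "transpose (G - mat l) *v d = 0"
    using assms(2) by (simp add: vector_matrix_mult_diff vector_matrix_mult_mat)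
  ultimately show False using assms(1) by blast
qed

lemma rowapp_matrix_vector_mult: "rowapp v (M *v u) = rowapp (v v* M) u"
  unfolding rowapp_def matrix_vector_mult_def vector_matrix_mult_def
  by (simp add: sum_distrib_left sum_distrib_right mult.assoc mult.left_commute) (rule sum.swap)

lemma rowapp_diff: "rowapp v (x - y) = rowapp v x - rowapp v y"
  unfolding rowapp_def by (simp add: right_diff_distrib sum_subtractf)

lemma rowapp_0_left [simp]: "rowapp 0 x = 0"
  unfolding rowapp_def by simp

lemma rowapp_axis: "rowapp v (axis i 1) = v $ i"
  unfolding rowapp_def axis_def by (simp add: if_distrib[of "\<lambda>t. _ * t"] cong: if_cong)

lemma monad_nonsingular_commute_if_CD_zero:
  assumes "monad_nonsingular A B c1 c2 d1 d2" "CD_mat c1 c2 d1 d2 = 0"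
  shows "A ** B = B ** A"
  using assms unfolding monad_nonsingular_def by (simp add: algebra_simps)

lemma monad_nonsingular_C_nonzero:
  assumes MN: "monad_nonsingular A B c1 c2 d1 d2"
  shows "c1 \<noteq> 0 \<or> c2 \<noteq> 0"
proof (rule ccontr)
  assume "\<not> (c1 \<noteq> 0 \<or> c2 \<noteq> 0)"
  then have c: "c1 = 0" "c2 = 0" by auto
  then have "CD_mat c1 c2 d1 d2 = 0" unfolding CD_mat_def outer_def by (simp add: vec_eq_iff)
  then obtain v x y where v: "v \<noteq> 0" "v v* A = x *s v" "v v* B = y *s v"
    using commuting_matrices_common_left_eigenvector monad_nonsingular_commute_if_CD_zero[OF MN]
    by blast
  then obtain i where "v $ i \<noteq> 0" by (auto simp: vec_eq_iff)
  from MN obtain u1 u2 a b where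
    w: "axis i 1 = - ((B - mat y) *v u1) + (A - mat x) *v u2 + a *s c1 + b *s c2"
    unfolding monad_nonsingular_def by blast
  \<comment> \<open>by surjectivity, \<open>v\<close> would annihilate every vector\<close>
  have "rowapp v (axis i 1) = 0"
    unfolding w c by (simp add: rowapp_diff rowapp_matrix_vector_mult v
        vector_matrix_mult_diff vector_matrix_mult_mat)
  with \<open>v $ i \<noteq> 0\<close> show False by (simp add: rowapp_axis)
qed

lemma monad_nonsingular_D_nonzero:
  assumes MN: "monad_nonsingular A B c1 c2 d1 d2"
  shows "d1 \<noteq> 0 \<or> d2 \<noteq> 0"
proof (rule ccontr)
  assume "\<not> (d1 \<noteq> 0 \<or> d2 \<noteq> 0)"
  then have d: "d1 = 0" "d2 = 0" by auto
  then have "CD_mat c1 c2 d1 d2 = 0" unfolding CD_mat_def outer_def by (simp add: vec_eq_iff)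
  then obtain v x y where v: "v \<noteq> 0" "A *v v = x *s v" "B *v v = y *s v"
    using commuting_matrices_common_eigenvector monad_nonsingular_commute_if_CD_zero[OF MN]
    by blast
  moreover have "(A - mat x) *v v = 0 \<and> (B - mat y) *v v = 0 \<and> rowapp d1 v = 0 \<and> rowapp d2 v = 0"
    using v d by (simp add: matrix_vector_mult_diff_rdistrib matrix_vector_mult_mat)
  ultimately show False using MN unfolding monad_nonsingular_def by blast
qed

lemma twisted_cycle_eigenvectors:
  fixes g A :: "complex^'n^'n"
  assumes gA: "g ** A = mat \<mu> ** A ** g"
    and c2: "g *v c2 = \<alpha> *s c1" and c1: "g *v (A *v c1) = \<beta> *s c2"
  shows "(mat s ** g ** g ** A) *v c1 = (s * \<alpha> * \<beta>) *s c1"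
    and "(mat s ** g ** g ** A) *v c2 = (s * \<mu> * \<alpha> * \<beta>) *s c2"
proof -
  have G: "(mat s ** g ** g ** A) *v u = s *s (g *v (g *v (A *v u)))" for u
    by (simp add: matrix_vector_mul_assoc matrix_vector_mult_mat flip: matrix_vector_mul_assoc)
  show "(mat s ** g ** g ** A) *v c1 = (s * \<alpha> * \<beta>) *s c1"
    by (simp add: G c1 c2 vector_scalar_commute mult.assoc)
  have "g *v (A *v c2) = (mat \<mu> ** A ** g) *v c2"
    by (simp add: matrix_vector_mul_assoc gA)
  then have "g *v (A *v c2) = \<mu> *s (A *v (g *v c2))"
    by (simp add: matrix_vector_mult_mat flip: matrix_vector_mul_assoc)
  then show "(mat s ** g ** g ** A) *v c2 = (s * \<mu> * \<alpha> * \<beta>) *s c2"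
    by (simp add: G c1 c2 vector_scalar_commute mult.assoc)
qed

lemma twisted_cycle_left_eigenvectors:
  fixes g A :: "complex^'n^'n"
  assumes gA: "g ** A = mat \<mu> ** A ** g"
    and d1: "d1 v* g = \<gamma> *s d2" and d2: "(d2 v* g) v* A = \<delta> *s d1"
  shows "d1 v* (mat s ** g ** g ** A) = (s * \<gamma> * \<delta>) *s d1"
    and "d2 v* (mat s ** g ** g ** A) = (s * \<mu> * \<gamma> * \<delta>) *s d2"
proof -
  have G: "u v* (mat s ** g ** g ** A) = s *s (((u v* g) v* g) v* A)" for u
    by (simp add: vector_matrix_mult_mat scalar_vector_matrix_assoc
        flip: vector_matrix_mul_assoc)
  show "d1 v* (mat s ** g ** g ** A) = (s * \<gamma> * \<delta>) *s d1"
    by (simp add: G d1 d2 scalar_vector_matrix_assoc mult.assoc)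
  have "((d2 v* g) v* g) v* A = (d2 v* g) v* (mat \<mu> ** A ** g)"
    by (simp add: vector_matrix_mul_assoc matrix_mul_assoc flip: gA)
  then have "((d2 v* g) v* g) v* A = \<mu> *s (((d2 v* g) v* A) v* g)"
    by (simp add: vector_matrix_mult_mat scalar_vector_matrix_assoc flip: vector_matrix_mul_assoc)
  then show "d2 v* (mat s ** g ** g ** A) = (s * \<mu> * \<gamma> * \<delta>) *s d2"
    by (simp add: G d1 d2 scalar_vector_matrix_assoc mult.assoc)
qed

lemma twisted_cycle_nonzero:
  fixes g A :: "complex^'n^'n"
  assumes "g *v c2 = \<alpha> *s c1" "g *v (A *v c1) = \<beta> *s c2" "\<alpha> \<noteq> 0" "\<beta> \<noteq> 0"
    and "c1 \<noteq> 0 \<or> c2 \<noteq> 0"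
  shows "c1 \<noteq> 0 \<and> c2 \<noteq> 0"
  using assms by (auto simp: vector_mul_eq_0)

lemma twisted_cycle_left_nonzero:
  fixes g A :: "complex^'n^'n"
  assumes "d1 v* g = \<gamma> *s d2" "(d2 v* g) v* A = \<delta> *s d1" "\<gamma> \<noteq> 0" "\<delta> \<noteq> 0"
    and "d1 \<noteq> 0 \<or> d2 \<noteq> 0"
  shows "d1 \<noteq> 0 \<and> d2 \<noteq> 0"
  using assms by (auto simp: vector_mul_eq_0)

lemma vector_scale_cancel:
  fixes x y :: "'a::field^'n"
  assumes "b \<noteq> 0" "a *s x = b *s y"
  shows "y = (a / b) *s x"
proof -
  have "y = inverse b *s (b *s y)" using assms(1) by (simp add: vector_smult_assoc)
  also have "\<dots> = (a / b) *s x" by (simp flip: assms(2) add: vector_smult_assoc field_simps)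
  finally show ?thesis .
qed

lemma rho_invariant_by_twisted_cycle:
  fixes A B g :: "complex^'k^'k"
  assumes R: "rho_invariant_by j \<omega> A B c1 c2 d1 d2 g" and "invertible A"
  defines "K \<equiv> real CARD('k)"
  defines "\<alpha> \<equiv> cis (pi / (2 * K) + real j * pi / (4 * K) - \<omega>)"
    and "\<beta> \<equiv> cis (pi / (2 * K) + 3 * real j * pi / (4 * K) + \<omega>)"
  shows "g ** A = mat (cis (real j * pi / K)) ** A ** g"
    and "g *v c2 = \<alpha> *s c1" and "g *v (A *v c1) = \<beta> *s c2"
    and "d1 v* g = inverse \<beta> *s d2" and "(d2 v* g) v* A = inverse \<alpha> *s d1"
proof -
  note R = R[unfolded rho_invariant_by_def Let_def, folded K_def]
  have g: "g ** matrix_inv g = mat 1" "matrix_inv g ** g = mat 1"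
    using R invertible_matrix_inv by auto
  have A: "A ** matrix_inv A = mat 1" "matrix_inv A ** A = mat 1"
    using \<open>invertible A\<close> invertible_matrix_inv by auto
  have \<alpha>: "cis (pi / (2 * K)) * cis (real j * pi / (4 * K)) / cis \<omega> = \<alpha>"
    unfolding \<alpha>_def by (simp add: cis_mult cis_divide)
  have \<beta>: "cis (pi / (2 * K)) * cis (3 * real j * pi / (4 * K)) / cis (- \<omega>) = \<beta>"
    unfolding \<beta>_def by (simp add: cis_mult cis_divide)
  have "mat (cis (real j * pi / K)) ** A ** g = g ** A ** (matrix_inv g ** g)"
    using R by (simp add: matrix_mul_assoc)
  then show "g ** A = mat (cis (real j * pi / K)) ** A ** g"
    using g by simp
  have "cis (pi / (2 * K)) * cis (real j * pi / (4 * K)) *s c1 = cis \<omega> *s (g *v c2)"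
    using R by simp
  from vector_scale_cancel[OF _ this] show "g *v c2 = \<alpha> *s c1"
    using \<alpha> by simp
  have "cis (pi / (2 * K)) * cis (3 * real j * pi / (4 * K)) *s c2 = cis (- \<omega>) *s (g *v (A *v c1))"
    using R by simp
  from vector_scale_cancel[OF _ this] show "g *v (A *v c1) = \<beta> *s c2"
    using \<beta> by simp
  have "cis (pi / (2 * K)) * cis (3 * real j * pi / (4 * K)) *s d1 = cis (- \<omega>) *s (d2 v* matrix_inv g)"
    using R by simp
  from vector_scale_cancel[OF _ this] have "d2 v* matrix_inv g = \<beta> *s d1"
    using \<beta> by simp
  then have "d2 = \<beta> *s (d1 v* g)"
    by (metis g(2) scalar_vector_matrix_assoc vector_matrix_mul_assoc vector_matrix_mul_rid)
  then show "d1 v* g = inverse \<beta> *s d2"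
    by (simp add: vector_smult_assoc \<beta>_def flip: cis_inverse)
  have "cis (pi / (2 * K)) * cis (real j * pi / (4 * K)) *s d2
      = cis \<omega> *s (d1 v* (matrix_inv A ** matrix_inv g))"
    using R by simp
  from vector_scale_cancel[OF _ this] have "d1 v* (matrix_inv A ** matrix_inv g) = \<alpha> *s d2"
    using \<alpha> by simp
  then have "d1 = \<alpha> *s ((d2 v* g) v* A)"
    by (metis A(2) g(2) matrix_mul_assoc scalar_vector_matrix_assoc vector_matrix_mul_assoc
        vector_matrix_mul_rid)
  then show "(d2 v* g) v* A = inverse \<alpha> *s d1"
    by (simp add: vector_smult_assoc \<alpha>_def flip: cis_inverse)
qed

lemma cis_eq_if_eq_add_2pi: "b = a + 2 * pi \<Longrightarrow> cis a = cis b"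
  by (simp add: complex_eq_iff)

lemma twisted_cycle_eigenvalues:
  fixes k j :: nat and \<omega> :: real
  assumes "k > 0" "even j"
  defines "K \<equiv> real k"
  defines "s \<equiv> cis (- (real j * pi / (2 * K)))" and "\<mu> \<equiv> cis (real j * pi / K)"
    and "\<alpha> \<equiv> cis (pi / (2 * K) + real j * pi / (4 * K) - \<omega>)"
    and "\<beta> \<equiv> cis (pi / (2 * K) + 3 * real j * pi / (4 * K) + \<omega>)"
  shows "s * \<alpha> * \<beta> = Omega_j k j * omega_r k (int j div 2)"
    and "s * \<mu> * \<alpha> * \<beta> = Omega_j k j * omega_r k (int j)"
    and "s * inverse \<beta> * inverse \<alpha> = Omega_j k j * omega_r k (int k - int j div 2 - 1)"
    and "s * \<mu> * inverse \<beta> * inverse \<alpha> = Omega_j k j * omega_r k (int k - 1)"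
proof -
  obtain m where j: "j = 2 * m" using \<open>even j\<close> by blast
  have K: "K > 0" "real k = K" using \<open>k > 0\<close> unfolding K_def by simp_all
  have m: "int j div 2 = int m" using j by simp
  note defs = Omega_j_def omega_r_def s_def \<mu>_def \<alpha>_def \<beta>_def j m K(2)
  show "s * \<alpha> * \<beta> = Omega_j k j * omega_r k (int j div 2)"
    unfolding defs by (simp add: cis_mult)
      (rule arg_cong[where f = cis], use K in \<open>simp add: field_simps\<close>)
  show "s * \<mu> * \<alpha> * \<beta> = Omega_j k j * omega_r k (int j)"
    unfolding defs by (simp add: cis_mult)
      (rule arg_cong[where f = cis], use K in \<open>simp add: field_simps\<close>)
  show "s * inverse \<beta> * inverse \<alpha> = Omega_j k j * omega_r k (int k - int j div 2 - 1)"
    unfolding defs by (simp add: cis_mult cis_inverse)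
      (rule cis_eq_if_eq_add_2pi, use K in \<open>simp add: field_simps\<close>)
  show "s * \<mu> * inverse \<beta> * inverse \<alpha> = Omega_j k j * omega_r k (int k - 1)"
    unfolding defs by (simp add: cis_mult cis_inverse)
      (rule cis_eq_if_eq_add_2pi, use K in \<open>simp add: field_simps\<close>)
qed

theorem mainTheorem8:
  fixes A B g :: "complex^'k^'k" and c1 c2 d1 d2 :: "complex^'k"
    and j :: nat and \<omega> :: real
  assumes "even j" and "j < 2 * CARD('k)"
    and "-pi < \<omega>" and "\<omega> < pi"
    and "(A, B, c1, c2, d1, d2) \<in> M_rho j \<omega>"
    and "rho_invariant_by j \<omega> A B c1 c2 d1 d2 g"
  defines "G \<equiv> mat (cis (- (real j * pi / (2 * real CARD('k))))) ** g ** g ** A"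
  defines "k \<equiv> CARD('k)"
  shows "c1 \<noteq> 0 \<and> c2 \<noteq> 0 \<and> d1 \<noteq> 0 \<and> d2 \<noteq> 0
    \<and> {Omega_j k j * omega_r k (int j div 2), Omega_j k j * omega_r k (int j),
        Omega_j k j * omega_r k (int k - int j div 2 - 1), Omega_j k j * omega_r k (int k - 1)}
       \<subseteq> Eval G
    \<and> c1 \<in> Evec G (Omega_j k j * omega_r k (int j div 2))
    \<and> c2 \<in> Evec G (Omega_j k j * omega_r k (int j))
    \<and> d1 \<in> Ecovec G (Omega_j k j * omega_r k (int k - int j div 2 - 1))
    \<and> d2 \<in> Ecovec G (Omega_j k j * omega_r k (int k - 1))"
proof -
  have MN: "monad_nonsingular A B c1 c2 d1 d2"
    using assms(5) unfolding M_rho_def by simp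
  then have "invertible A" unfolding monad_nonsingular_def by simp
  note cycle = rho_invariant_by_twisted_cycle[OF assms(6) this]
  have c: "c1 \<noteq> 0 \<and> c2 \<noteq> 0"
    by (rule twisted_cycle_nonzero[OF cycle(2,3) _ _ monad_nonsingular_C_nonzero[OF MN]]) simp_all
  have d: "d1 \<noteq> 0 \<and> d2 \<noteq> 0"
    by (rule twisted_cycle_left_nonzero[OF cycle(4,5) _ _ monad_nonsingular_D_nonzero[OF MN]]) simp_all
  have "k > 0" unfolding k_def by simp
  note eigenvalues = twisted_cycle_eigenvalues[OF this assms(1), of \<omega>]
  have "G *v c1 = (Omega_j k j * omega_r k (int j div 2)) *s c1"
    and "G *v c2 = (Omega_j k j * omega_r k (int j)) *s c2"
    unfolding G_def k_def eigenvalues(1,2)[unfolded k_def, symmetric]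
    by (rule twisted_cycle_eigenvectors[OF cycle(1-3)])+
  moreover have "d1 v* G = (Omega_j k j * omega_r k (int k - int j div 2 - 1)) *s d1"
    and "d2 v* G = (Omega_j k j * omega_r k (int k - 1)) *s d2"
    unfolding G_def k_def eigenvalues(3,4)[unfolded k_def, symmetric]
    by (rule twisted_cycle_left_eigenvectors[OF cycle(1,4,5)])+
  ultimately show ?thesis
    using c d left_eigenvalue_in_Eval unfolding Evec_def Ecovec_def Eval_def by auto
qed

end
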